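(* Let $p,q\in(1,\infty)$ and $r,A,B,C,D\in\mathcal{P}(\mathbb{R}^n)$ be such that $1<r^-<r^+<+\infty$, $\frac1p+\frac1q=1$, and, for (almost) every $x\in\mathbb{R}^n$, $\frac{A(x)}{p\,(r')^-}+\frac{C(x)}{r^-}=1$ and $\frac{B(x)}{q\,(r')^-}+\frac{D(x)}{r^-}=1$. If $k\in L^{A(\cdot)}(\mathbb{R}^n)\cap L^{C(\cdot)}(\mathbb{R}^n)\cap L^\infty(\mathbb{R}^n)$ and $f\in L^{B(\cdot)}(\mathbb{R}^n)\cap L^{D(\cdot)}(\mathbb{R}^n)\cap L^\infty(\mathbb{R}^n)$, then $$\|k*f\|_{L^{r(\cdot)}(\mathbb{R}^n)}\le\|k\|_{L^{A(\cdot)}(\mathbb{R}^n)\cap L^{C(\cdot)}(\mathbb{R}^n)\cap L^\infty(\mathbb{R}^n)}\,\|f\|_{L^{B(\cdot)}(\mathbb{R}^n)\cap L^{D(\cdot)}(\mathbb{R}^n)\cap L^\infty(\mathbb{R}^n)}.$$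
   Context: $\mathcal{P}(\mathbb{R}^n)$ is the set of measurable functions $p:\mathbb{R}^n\to[1,\infty]$; $p^-$ and $p^+$ are the essential infimum and supremum of $p$; $p'$ is the pointwise conjugate exponent, $\frac1{p(x)}+\frac1{p'(x)}=1$ with $\frac1\infty:=0$, and $(r')^-$ is the essential infimum of $r'$. The modular is $\varrho_{p(\cdot)}(f)=\int_{\mathbb{R}^n}\omega_{p(x)}(|f(x)|)\,dx$, with $\omega_p(t)=t^p$ if $p<\infty$, and $\omega_\infty(t)=0$ for $t\le1$, $\omega_\infty(t)=\infty$ for $t>1$. $L^{p(\cdot)}(\mathbb{R}^n)$ is the space of measurable $f$ with $\varrho_{p(\cdot)}(\lambda f)<\infty$ for some $\lambda>0$, normed by $\|f\|_{L^{p(\cdot)}}=\inf\{\lambda>0:\varrho_{p(\cdot)}(f/\lambda)\le1\}$. An intersection of normed spaces carries the maximum of the norms. *)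

theory Defs
  imports "HOL-Analysis.Analysis" "HOL-Probability.Essential_Supremum"
begin

text \<open>
  Exponents take values in \<^typ>\<open>ennreal\<close>, where \<open>1 / \<infinity> = 0\<close>. Norms and modulars are
  \<^typ>\<open>ennreal\<close>-valued, so that an infinite value is never hidden. Measurability and integrals
  are with respect to Lebesgue measure on the completed sigma-algebra.
\<close>

definition exponents :: "(real ^ 'n \<Rightarrow> ennreal) set" where
  "exponents = {p \<in> borel_measurable lebesgue. \<forall>x. 1 \<le> p x}"

definition essinf :: "'a measure \<Rightarrow> ('a \<Rightarrow> 'b::complete_linorder) \<Rightarrow> 'b" where
  "essinf M f = Sup {z. AE x in M. z \<le> f x}"

text \<open>The solution \<open>p'\<close> of \<open>1 / p + 1 / p' = 1\<close>, including \<open>1' = \<infinity>\<close> and \<open>\<infinity>' = 1\<close>.\<close>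

definition conj_exp :: "ennreal \<Rightarrow> ennreal" where
  "conj_exp p = 1 / (1 - 1 / p)"

lemma conj_exp_iff:
  assumes "1 \<le> p"
  shows "1 / p + 1 / p' = 1 \<longleftrightarrow> p' = conj_exp p"
proof -
  have inv: "inverse (inverse x) = x" for x :: ennreal
    by (cases x rule: ennreal_cases; cases "x = 0") (auto simp: inverse_ennreal less_le)
  have le: "inverse p \<le> 1"
    using assms by (cases p rule: ennreal_cases)
      (auto simp: inverse_ennreal inverse_le_1_iff simp flip: ennreal_1)
  have "inverse p + inverse p' = 1 \<longleftrightarrow> inverse p' = 1 - inverse p"
  proof
    assume "inverse p + inverse p' = 1"
    moreover have "inverse p \<noteq> \<infinity>"
      using le by (auto simp: top_unique)
    ultimately show "inverse p' = 1 - inverse p"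
      by (metis ennreal_add_diff_cancel_left infinity_ennreal_def)
  qed (use le in \<open>simp add: add_diff_inverse_ennreal\<close>)
  also have "\<dots> \<longleftrightarrow> p' = inverse (1 - inverse p)"
    by (metis inv)
  finally show ?thesis
    by (simp add: conj_exp_def divide_ennreal_def)
qed

text \<open>The function \<open>\<omega>\<^sub>p(t)\<close>, used for \<open>t \<ge> 0\<close> and \<open>p \<ge> 1\<close> only.\<close>

definition omega :: "ennreal \<Rightarrow> real \<Rightarrow> ennreal" where
  "omega p t = (if p = \<infinity> then (if t \<le> 1 then 0 else \<infinity>) else ennreal (t powr enn2real p))"

definition modular :: "(real ^ 'n \<Rightarrow> ennreal) \<Rightarrow> (real ^ 'n \<Rightarrow> 'b::real_normed_vector) \<Rightarrow> ennreal" where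
  "modular p f = (\<integral>\<^sup>+ x. omega (p x) (norm (f x)) \<partial>lebesgue)"

definition Lvar :: "(real ^ 'n \<Rightarrow> ennreal) \<Rightarrow> (real ^ 'n \<Rightarrow> 'b::real_normed_vector) set" where
  "Lvar p = {f \<in> borel_measurable lebesgue. \<exists>l>0. modular p (\<lambda>x. l *\<^sub>R f x) < \<infinity>}"

definition Lvar_norm :: "(real ^ 'n \<Rightarrow> ennreal) \<Rightarrow> (real ^ 'n \<Rightarrow> 'b::real_normed_vector) \<Rightarrow> ennreal" where
  "Lvar_norm p f = Inf {ennreal l | l. 0 < l \<and> modular p (\<lambda>x. f x /\<^sub>R l) \<le> 1}"

text \<open>\<open>L\<^sup>\<infinity>\<close> is the member of the scale with constant exponent \<open>\<infinity>\<close>.\<close>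

abbreviation Linf :: "(real ^ 'n \<Rightarrow> 'b::real_normed_vector) set" where
  "Linf \<equiv> Lvar (\<lambda>_. \<infinity>)"

abbreviation Linf_norm :: "(real ^ 'n \<Rightarrow> 'b::real_normed_vector) \<Rightarrow> ennreal" where
  "Linf_norm \<equiv> Lvar_norm (\<lambda>_. \<infinity>)"

lemma modular_infinity:
  fixes f :: "real ^ 'n \<Rightarrow> 'b::real_normed_vector"
  assumes [measurable]: "f \<in> borel_measurable lebesgue"
  shows "modular (\<lambda>_. \<infinity>) f = (if AE x in lebesgue. norm (f x) \<le> 1 then 0 else \<infinity>)"
proof -
  let ?S = "{x \<in> space lebesgue. 1 < norm (f x)}"
  have S: "?S \<in> sets lebesgue" by measurable
  have "modular (\<lambda>_. \<infinity>) f = (\<integral>\<^sup>+ x. \<infinity> * indicator ?S x \<partial>lebesgue)"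
    unfolding modular_def omega_def by (intro nn_integral_cong) (auto simp: indicator_def)
  also have "\<dots> = \<infinity> * emeasure lebesgue ?S"
    using S by (rule nn_integral_cmult_indicator)
  also have "\<dots> = (if emeasure lebesgue ?S = 0 then 0 else \<infinity>)"
    by (simp add: ennreal_top_mult)
  also have "emeasure lebesgue ?S = 0 \<longleftrightarrow> (AE x in lebesgue. norm (f x) \<le> 1)"
    using AE_iff_measurable[OF S, of "\<lambda>x. norm (f x) \<le> 1"] by (simp add: not_le)
  finally show ?thesis .
qed

lemma Linf_norm_eq_esssup:
  fixes f :: "real ^ 'n \<Rightarrow> 'b::real_normed_vector"
  assumes f[measurable]: "f \<in> borel_measurable lebesgue"
  shows "Linf_norm f = esssup lebesgue (\<lambda>x. ennreal (norm (f x)))"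
proof -
  have "modular (\<lambda>_. \<infinity>) (\<lambda>x. f x /\<^sub>R l) \<le> 1 \<longleftrightarrow> (AE x in lebesgue. norm (f x) \<le> l)"
    if "0 < l" for l
  proof -
    have "(\<lambda>x. f x /\<^sub>R l) \<in> borel_measurable lebesgue"
      by measurable
    moreover have "norm (f x /\<^sub>R l) \<le> 1 \<longleftrightarrow> norm (f x) \<le> l" for x
      using that by (simp add: field_simps)
    ultimately show ?thesis
      by (simp only: modular_infinity) (simp add: top_unique)
  qed
  note * = this[unfolded infinity_ennreal_def]
  let ?e = "esssup lebesgue (\<lambda>x. ennreal (norm (f x)))"
  show ?thesis
  proof (rule antisym)
    show "?e \<le> Linf_norm f"
      unfolding Lvar_norm_def by (rule Inf_greatest) (auto simp: * intro!: esssup_I ennreal_leI)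
    show "Linf_norm f \<le> ?e"
    proof (rule dense_ge)
      fix y assume y: "?e < y"
      show "Linf_norm f \<le> y"
      proof (cases y)
        case (real l)
        then have l: "0 < l" using y by (metis ennreal_0 le_less not_less_zero)
        have "AE x in lebesgue. norm (f x) \<le> l"
          using esssup_AE[of "\<lambda>x. ennreal (norm (f x))" lebesgue]
        proof eventually_elim
          case (elim x)
          then have "ennreal (norm (f x)) \<le> ennreal l" using y real by (metis le_less_trans less_imp_le)
          then show ?case using l by simp
        qed
        then show ?thesis
          unfolding Lvar_norm_def using l real * by (intro Inf_lower) auto
      qed simp
    qed
  qed
qed

text \<open>The integral is \<open>0\<close> by convention at points where the integrand is not integrable.\<close>

definition convol :: "(real ^ 'n \<Rightarrow> 'b::{real_normed_field, euclidean_space}) \<Rightarrow>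
    (real ^ 'n \<Rightarrow> 'b) \<Rightarrow> real ^ 'n \<Rightarrow> 'b" where
  "convol k f x = (LINT y|lebesgue. k (x - y) * f y)"

end

theory Submission
  imports Defs
begin

text \<open>
  After rescaling, all modulars are at most \<open>1\<close> and \<open>|k|, |f| \<le> 1\<close> a.e. Write
  \<open>s = (r')\<^sup>-\<close>, \<open>m = r\<^sup>-\<close>, and split \<open>|k(x-y) f(y)| = g h\<close> with
  \<open>g = |k|\<^bsup>A/(ps)\<^esup> |f|\<^bsup>B/(qs)\<^esup>\<close> and \<open>h = |k|\<^bsup>C/m\<^esup> |f|\<^bsup>D/m\<^esup>\<close>.
  Since the bases are at most \<open>1\<close>, \<open>g\<^bsup>r'(x)\<^esup> \<le> |k|\<^bsup>A/p\<^esup> |f|\<^bsup>B/q\<^esup> \<le> |k|\<^sup>A/p + |f|\<^sup>B/q\<close>,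
  which has integral at most \<open>1\<close>, and \<open>h\<^bsup>r(x)\<^esup> \<le> |k|\<^sup>C |f|\<^sup>D\<close>. Hoelder in \<open>y\<close> then gives
  \<open>|(k * f)(x)|\<^bsup>r(x)\<^esup> \<le> H(x) = \<integral> |k(x-y)|\<^bsup>C(x-y)\<^esup> |f(y)|\<^bsup>D(y)\<^esup> dy\<close>, and \<open>\<integral> H \<le> 1\<close> by Fubini.
\<close>

section \<open>Essential infimum and conjugate exponents\<close>

text \<open>A supremum in \<open>ennreal\<close> is already attained along a sequence from the set,
  so only countably many exceptional null sets have to be united.\<close>

lemma essinf_AE:
  fixes f :: "'a \<Rightarrow> ennreal"
  shows "AE x in M. essinf M f \<le> f x"
proof -
  let ?Z = "{z. AE x in M. z \<le> f x}"
  have "0 \<in> ?Z" by simp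
  then obtain u :: "nat \<Rightarrow> ennreal" where u: "range u \<subseteq> ?Z" "Sup ?Z = (SUP i. u i)"
    using ennreal_Sup_countable_SUP[of ?Z] by blast
  have "AE x in M. \<forall>i. u i \<le> f x"
    using u(1) by (subst AE_all_countable) auto
  then show ?thesis
    unfolding essinf_def u(2) by eventually_elim (auto intro: SUP_least)
qed

lemma conj_exp_ennreal:
  assumes "1 < \<rho>"
  shows "conj_exp (ennreal \<rho>) = ennreal (\<rho> / (\<rho> - 1))"
proof -
  have "1 - 1 / ennreal \<rho> = ennreal (1 - 1 / \<rho>)"
    using assms by (simp add: divide_ennreal ennreal_minus flip: ennreal_1)
  moreover have "0 < 1 - 1 / \<rho>" and "1 / (1 - 1 / \<rho>) = \<rho> / (\<rho> - 1)"
    using assms by (auto simp: field_simps)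
  ultimately show ?thesis
    by (metis conj_exp_def divide_ennreal ennreal_1 zero_le_one)
qed

section \<open>Modulars and the norms they define\<close>

lemma omega_measurable [measurable]:
  assumes [measurable]: "p \<in> borel_measurable M" "t \<in> borel_measurable M"
  shows "(\<lambda>x. omega (p x) (t x)) \<in> borel_measurable M"
  unfolding omega_def by measurable

lemma omega_mono: "0 \<le> t \<Longrightarrow> t \<le> u \<Longrightarrow> omega p t \<le> omega p u"
  by (auto simp: omega_def intro!: powr_mono2)

text \<open>For a finite exponent this is \<open>c powr p \<le> c\<close>, which follows from
  \<open>c \<le> 1 \<le> p\<close>; for an infinite one, the right side is 0 or infinity and only
  \<open>t \<le> 1\<close> needs an argument. The bound takes the place of convexity of the
  modular.\<close>

lemma omega_mult_le:
  assumes "0 < c" "c \<le> 1" "0 \<le> t" "1 \<le> p"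
  shows "omega p (c * t) \<le> ennreal c * omega p t"
proof (cases "p = \<infinity>")
  case True
  have "c * t \<le> 1" if "t \<le> 1"
    using assms that by (simp add: mult_le_one)
  then show ?thesis
    using True assms by (auto simp: omega_def ennreal_mult_top)
next
  case False
  then have "1 \<le> enn2real p"
    using assms(4) by (cases p) auto
  then have "c powr enn2real p \<le> c powr 1"
    using assms by (intro powr_mono') auto
  then show ?thesis
    using False assms
    by (auto simp: omega_def powr_mult mult_right_mono intro!: ennreal_leI simp flip: ennreal_mult)
qed

lemma modular_scaled_mono:
  assumes "0 < l" "l \<le> l'" "modular p (\<lambda>x. f x /\<^sub>R l) \<le> 1"
  shows "modular p (\<lambda>x. f x /\<^sub>R l') \<le> 1"
proof -
  have "modular p (\<lambda>x. f x /\<^sub>R l') \<le> modular p (\<lambda>x. f x /\<^sub>R l)"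
    unfolding modular_def using assms(1,2)
    by (intro nn_integral_mono omega_mono) (auto intro!: mult_right_mono le_imp_inverse_le)
  then show ?thesis using assms(3) by simp
qed

text \<open>A strict bound on the infimum yields an admissible scale below \<open>a\<close>, and
  admissible scales are upward closed. Whether the infimum is attained therefore never
  matters.\<close>

lemma modular_le_1_of_norm_less:
  assumes "Lvar_norm p f < ennreal a"
  shows "modular p (\<lambda>x. f x /\<^sub>R a) \<le> 1"
proof -
  obtain l where l: "0 < l" "modular p (\<lambda>x. f x /\<^sub>R l) \<le> 1" "ennreal l < ennreal a"
    using assms unfolding Lvar_norm_def Inf_less_iff by blast
  then have "l \<le> a"
    by (metis ennreal_less_iff less_imp_le)
  with l show ?thesis by (blast intro: modular_scaled_mono)
qed

text \<open>Membership gives a finite modular at one scale only. Shrinking by a further factor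
  \<open>c \<le> 1\<close> multiplies it by at most \<open>c\<close>, which brings it below
  1.\<close>

lemma Lvar_norm_finite:
  assumes f: "f \<in> Lvar p" and [measurable]: "p \<in> borel_measurable lebesgue"
    and p: "\<And>x. 1 \<le> p x"
  shows "Lvar_norm p f < \<infinity>"
proof -
  obtain l where [measurable]: "f \<in> borel_measurable lebesgue"
    and l: "0 < l" "modular p (\<lambda>x. l *\<^sub>R f x) < \<infinity>"
    using f unfolding Lvar_def by blast
  obtain M where M: "modular p (\<lambda>x. l *\<^sub>R f x) = ennreal M" "0 \<le> M"
    using l(2) by (cases "modular p (\<lambda>x. l *\<^sub>R f x)") auto
  \<comment> \<open>The maximum with 1 keeps \<open>c \<le> 1\<close> even for small
    \<open>M\<close>, and \<open>c * M \<le> 1\<close> still holds.\<close>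
  define c where "c = 1 / max 1 M"
  have c: "0 < c" "c \<le> 1" "c * M \<le> 1"
    unfolding c_def by (auto simp: max_def)
  have "modular p (\<lambda>x. f x /\<^sub>R (1 / (c * l)))
      \<le> (\<integral>\<^sup>+ x. ennreal c * omega (p x) (norm (l *\<^sub>R f x)) \<partial>lebesgue)"
    unfolding modular_def
  proof (rule nn_integral_mono)
    fix x
    show "omega (p x) (norm (f x /\<^sub>R (1 / (c * l)))) \<le> ennreal c * omega (p x) (norm (l *\<^sub>R f x))"
      using omega_mult_le[OF c(1,2) _ p, of "norm (l *\<^sub>R f x)" x] c(1) l(1)
      by (simp add: abs_mult mult.assoc)
  qed
  also have "\<dots> = ennreal c * modular p (\<lambda>x. l *\<^sub>R f x)"
    unfolding modular_def by (rule nn_integral_cmult) measurable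
  also have "\<dots> \<le> 1"
    using M c by (simp flip: ennreal_mult)
  finally have "Lvar_norm p f \<le> ennreal (1 / (c * l))"
    unfolding Lvar_norm_def using c l by (intro Inf_lower) auto
  then show ?thesis
    using le_less_trans by fastforce
qed

section \<open>The pointwise Young estimate\<close>

text \<open>Young's inequality with a free scale \<open>t\<close>; the choice \<open>t\<^sup>\<rho> = H(x)\<close> after integration
  yields Hoelder's inequality (approximately, to cover \<open>H(x) = 0\<close>).\<close>

lemma powr_product_le:
  fixes a b p q \<alpha> \<beta> \<gamma> \<delta> s m \<rho> t :: real
  assumes a: "0 \<le> a" "a \<le> 1" and b: "0 \<le> b" "b \<le> 1"
    and pq: "1 < p" "1 < q" "1 / p + 1 / q = 1"
    and nonneg: "0 \<le> \<alpha>" "0 \<le> \<beta>" "0 \<le> \<gamma>" "0 \<le> \<delta>"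
    and s: "0 < s" "s \<le> \<rho> / (\<rho> - 1)" and m: "0 < m" "m \<le> \<rho>"
    and \<rho>: "1 < \<rho>"
    and A: "\<alpha> / (p * s) + \<gamma> / m = 1" and B: "\<beta> / (q * s) + \<delta> / m = 1"
    and t: "0 < t"
  shows "a * b \<le> t * ((1 - 1 / \<rho>) * (a powr \<alpha> / p + b powr \<beta> / q)
    + a powr \<gamma> * b powr \<delta> / (\<rho> * t powr \<rho>))"
proof (cases "a = 0 \<or> b = 0")
  case True
  then show ?thesis
    using a b pq \<rho> t by (auto intro!: mult_nonneg_nonneg add_nonneg_nonneg)
next
  case False
  with a b have pos: "0 < a" "0 < b" by auto
  \<comment> \<open>In the application \<open>\<rho>\<close> is the value of \<open>r\<close> at a
    point, so \<open>\<sigma>\<close> is the value of its conjugate there, and \<open>s\<close>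
    bounds it from below.\<close>
  define \<sigma> where "\<sigma> = \<rho> / (\<rho> - 1)"
  have \<sigma>: "1 < \<sigma>" "1 / \<sigma> = 1 - 1 / \<rho>" "1 / \<sigma> + 1 / \<rho> = 1"
    using \<rho> by (auto simp: \<sigma>_def field_simps)
  define g where "g = a powr (\<alpha> / (p * s)) * b powr (\<beta> / (q * s))"
  define h where "h = a powr (\<gamma> / m) * b powr (\<delta> / m)"
  have "g * h = a powr (\<alpha> / (p * s) + \<gamma> / m) * b powr (\<beta> / (q * s) + \<delta> / m)"
    unfolding g_def h_def powr_add by simp
  then have gh: "g * h = a * b"
    using pos by (simp add: A B)
  \<comment> \<open>Since \<open>s \<le> \<sigma>\<close>, the exponent produced by raising to the
    power \<open>\<sigma>\<close> is at least \<open>u / p\<close>, and a larger exponent makes a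
    power of a base in [0,1] smaller. \<open>ex'\<close> does the same for
    \<open>m \<le> \<rho>\<close>.\<close>
  have ex: "u / p \<le> u / (p * s) * \<sigma>" if "0 \<le> u" "0 < p" for u p
  proof -
    have "u / p * 1 \<le> u / p * (\<sigma> / s)"
      using s that by (intro mult_left_mono) (auto simp: \<sigma>_def[symmetric])
    then show ?thesis by (simp add: field_simps)
  qed
  have ex': "u \<le> u / m * \<rho>" if "0 \<le> u" for u
  proof -
    have "u * 1 \<le> u * (\<rho> / m)"
      using m that by (intro mult_left_mono) auto
    then show ?thesis by (simp add: field_simps)
  qed
  have "g powr \<sigma> = a powr (\<alpha> / (p * s) * \<sigma>) * b powr (\<beta> / (q * s) * \<sigma>)"
    unfolding g_def by (simp add: powr_mult powr_powr)
  also have "\<dots> \<le> a powr (\<alpha> / p) * b powr (\<beta> / q)"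
    using a b pq nonneg by (intro mult_mono powr_mono' ex) auto
  also have "\<dots> \<le> (a powr (\<alpha> / p)) powr p / p + (b powr (\<beta> / q)) powr q / q"
    using pq by (intro Youngs_inequality) auto
  finally have g: "g powr \<sigma> \<le> a powr \<alpha> / p + b powr \<beta> / q"
    using pq by (simp add: powr_powr)
  have "h powr \<rho> = a powr (\<gamma> / m * \<rho>) * b powr (\<delta> / m * \<rho>)"
    unfolding h_def by (simp add: powr_mult powr_powr)
  also have "\<dots> \<le> a powr \<gamma> * b powr \<delta>"
    using a b nonneg by (intro mult_mono powr_mono' ex') auto
  finally have h: "h powr \<rho> \<le> a powr \<gamma> * b powr \<delta>" .
  \<comment> \<open>Young's inequality is applied to \<open>g\<close> and \<open>h / t\<close>;
    multiplying by \<open>t\<close> at the end restores \<open>g * h = a * b\<close>.\<close>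
  have "g * (h / t) \<le> g powr \<sigma> / \<sigma> + (h / t) powr \<rho> / \<rho>"
    using \<sigma> \<rho> t by (intro Youngs_inequality) (auto simp: g_def h_def)
  also have "\<dots> = (1 - 1 / \<rho>) * g powr \<sigma> + h powr \<rho> / (\<rho> * t powr \<rho>)"
    using t by (simp add: \<sigma>(2)[symmetric] powr_divide h_def)
  also have "\<dots> \<le> (1 - 1 / \<rho>) * (a powr \<alpha> / p + b powr \<beta> / q)
      + a powr \<gamma> * b powr \<delta> / (\<rho> * t powr \<rho>)"
    using g h \<rho> t by (intro add_mono mult_left_mono divide_right_mono) auto
  finally have "t * (g * (h / t)) \<le> t * ((1 - 1 / \<rho>) * (a powr \<alpha> / p + b powr \<beta> / q)
      + a powr \<gamma> * b powr \<delta> / (\<rho> * t powr \<rho>))"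
    using t by (intro mult_left_mono) auto
  then show ?thesis using t gh by simp
qed

section \<open>Borel representatives, reflections and translations\<close>

text \<open>The real-valued case is applied to each coordinate; the basis is finite, so the
  exceptional sets unite to a null set.\<close>

lemma lebesgue_ex_borel:
  fixes f :: "'a::euclidean_space \<Rightarrow> 'b::euclidean_space"
  assumes [measurable]: "f \<in> borel_measurable lebesgue"
  obtains g where "g \<in> borel_measurable lborel" "AE x in lborel. f x = g x"
proof -
  have "\<forall>i\<in>Basis. \<exists>g\<in>borel_measurable lborel. AE x in lborel. f x \<bullet> i = g x"
    by (intro ballI completion_ex_borel_measurable_real) measurable
  then obtain g where g: "\<And>i. i \<in> Basis \<Longrightarrow> g i \<in> borel_measurable lborel"
    "\<And>i. i \<in> Basis \<Longrightarrow> AE x in lborel. f x \<bullet> i = g i x"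
    by metis
  have "AE x in lborel. \<forall>i\<in>Basis. f x \<bullet> i = g i x"
    using g(2) by (intro AE_finite_allI) auto
  then have "AE x in lborel. f x = (\<Sum>i\<in>Basis. g i x *\<^sub>R i)"
    by eventually_elim (metis (no_types, lifting) euclidean_representation sum.cong)
  moreover have "(\<lambda>x. \<Sum>i\<in>Basis. g i x *\<^sub>R i) \<in> borel_measurable lborel"
    using g(1) by (intro borel_measurable_sum borel_measurable_scaleR) auto
  ultimately show thesis using that by blast
qed

text \<open>The affine change of variables has the factor |-1| to the power of the dimension, that
  is 1.\<close>

lemma lborel_distr_reflect:
  fixes x :: "'a::euclidean_space"
  shows "distr lborel borel (\<lambda>y. x - y) = lborel"
  by (subst (2) lborel_affine[of "-1" x]) (auto simp: density_1)

lemma AE_lborel_reflect: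
  fixes x :: "'a::euclidean_space"
  assumes "AE y in lborel. P y"
  shows "AE y in lborel. P (x - y)"
proof (rule AE_distrD[of "\<lambda>y. x - y" lborel borel])
  show "AE y in distr lborel borel (\<lambda>y. x - y). P y"
    unfolding lborel_distr_reflect by fact
qed simp

lemma nn_integral_lborel_reflect:
  fixes x :: "'a::euclidean_space"
  assumes "f \<in> borel_measurable borel"
  shows "(\<integral>\<^sup>+ y. f (x - y) \<partial>lborel) = (\<integral>\<^sup>+ y. f y \<partial>lborel)"
  using nn_integral_distr[of "\<lambda>y. x - y" lborel borel f] assms by (simp add: lborel_distr_reflect)

lemma nn_integral_lborel_shift:
  fixes y :: "'a::euclidean_space"
  assumes "f \<in> borel_measurable borel"
  shows "(\<integral>\<^sup>+ x. f (x - y) \<partial>lborel) = (\<integral>\<^sup>+ x. f x \<partial>lborel)"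
  using nn_integral_distr[of "(+) (-y)" lborel borel f] assms
  by (simp add: lborel_distr_plus)


text \<open>For the completed domain and target, preimages of null sets must be controlled besides
  those of Borel sets; invariance of the measure under reflection does this.\<close>

lemma measurable_lebesgue_reflect:
  fixes x :: "'a::euclidean_space"
  shows "(\<lambda>y. x - y) \<in> lebesgue \<rightarrow>\<^sub>M lebesgue"
proof (rule completion.measurable_completion2)
  have "(\<lambda>y. x - y) \<in> lborel \<rightarrow>\<^sub>M lborel" by simp
  then show "(\<lambda>y. x - y) \<in> lebesgue \<rightarrow>\<^sub>M lborel"
    by (rule measurable_completion)
  have "distr lebesgue lborel (\<lambda>y. x - y) = distr lborel lborel (\<lambda>y. x - y)"
    by (rule distr_completion) simp
  also have "\<dots> = distr lborel borel (\<lambda>y. x - y)"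
    by (rule distr_cong) auto
  finally show "null_sets lborel \<subseteq> null_sets (distr lebesgue lborel (\<lambda>y. x - y))"
    by (simp add: lborel_distr_reflect)
qed

text \<open>A Lebesgue-measurable function composed with subtraction need not be measurable for the
  product \<open>\<sigma>\<close>-algebra, so Fubini is applied to Borel representatives.\<close>

lemma convolution_AE_cong:
  fixes k f :: "real ^ 'n \<Rightarrow> 'b::{real_normed_field, euclidean_space}"
  assumes [measurable]: "k \<in> borel_measurable lebesgue" "f \<in> borel_measurable lebesgue"
    "k' \<in> borel_measurable lborel" "f' \<in> borel_measurable lborel"
    and eq: "AE x in lborel. k x = k' x" "AE x in lborel. f x = f' x"
  shows "integrable lebesgue (\<lambda>y. k (x - y) * f y) \<longleftrightarrow> integrable lborel (\<lambda>y. k' (x - y) * f' y)"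
    and "convol k f x = (LINT y|lborel. k' (x - y) * f' y)"
proof -
  have "(\<lambda>y. k (x - y)) \<in> borel_measurable lebesgue"
    using measurable_comp[OF measurable_lebesgue_reflect assms(1)] by (simp add: comp_def)
  then have m: "(\<lambda>y. k (x - y) * f y) \<in> borel_measurable lebesgue"
    by measurable
  have b: "(\<lambda>y. k' (x - y) * f' y) \<in> borel_measurable lborel"
    by measurable
  have "AE y in lborel. k (x - y) * f y = k' (x - y) * f' y"
    using AE_lborel_reflect[OF eq(1), of x] eq(2) by eventually_elim simp
  then have ae: "AE y in lebesgue. k (x - y) * f y = k' (x - y) * f' y"
    by (rule AE_completion)
  show "integrable lebesgue (\<lambda>y. k (x - y) * f y) \<longleftrightarrow> integrable lborel (\<lambda>y. k' (x - y) * f' y)"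
    using integrable_cong_AE[OF m measurable_completion[OF b] ae] integrable_completion[OF b] by simp
  show "convol k f x = (LINT y|lborel. k' (x - y) * f' y)"
    unfolding convol_def
    using integral_cong_AE[OF m measurable_completion[OF b] ae] integral_completion[OF b] by simp
qed

text \<open>One Borel function replaces the whole power, so that the modular becomes an integral to
  which translation and Tonelli apply. Finiteness of the exponent reduces \<open>omega\<close> to a
  power.\<close>

lemma modular_representative:
  fixes k :: "real ^ 'n \<Rightarrow> 'b::{real_normed_vector, second_countable_topology}"
  assumes [measurable]: "k \<in> borel_measurable lebesgue" "A \<in> borel_measurable lebesgue"
    and fin: "AE x in lebesgue. A x < \<infinity>"
  obtains u :: "real ^ 'n \<Rightarrow> real" where "u \<in> borel_measurable lborel" "\<And>x. 0 \<le> u x"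
    "AE x in lborel. norm (k x) powr enn2real (A x) = u x"
    "(\<integral>\<^sup>+ x. ennreal (u x) \<partial>lborel) = modular A k"
proof -
  obtain v where v: "v \<in> borel_measurable lborel"
    "AE x in lborel. norm (k x) powr enn2real (A x) = v x"
    using completion_ex_borel_measurable_real[of "\<lambda>x. norm (k x) powr enn2real (A x)" lborel]
    by (auto; measurable)
  have fin': "AE x in lborel. A x < \<infinity>"
    using fin by (simp add: AE_completion_iff)
  \<comment> \<open>The representative is known to be nonnegative only a.e.; truncating it at 0
    makes it so everywhere.\<close>
  have ae: "AE x in lborel. norm (k x) powr enn2real (A x) = max 0 (v x)"
    using v(2) by eventually_elim (metis max.absorb2 powr_ge_zero)
  have "(\<integral>\<^sup>+ x. ennreal (max 0 (v x)) \<partial>lborel) = (\<integral>\<^sup>+ x. omega (A x) (norm (k x)) \<partial>lborel)"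
    using ae fin' by (intro nn_integral_cong_AE, eventually_elim) (auto simp: omega_def)
  then show thesis
    using v(1) ae by (intro that[of "\<lambda>x. max 0 (v x)"]) (auto simp: modular_def nn_integral_completion)
qed

text \<open>Tonelli, then translation invariance in \<open>x\<close> for each fixed
  \<open>y\<close>.\<close>

lemma nn_integral_convolution:
  fixes u v :: "'a::euclidean_space \<Rightarrow> ennreal"
  assumes [measurable]: "u \<in> borel_measurable borel" "v \<in> borel_measurable borel"
  shows "(\<integral>\<^sup>+ x. \<integral>\<^sup>+ y. u (x - y) * v y \<partial>lborel \<partial>lborel)
    = (\<integral>\<^sup>+ x. u x \<partial>lborel) * (\<integral>\<^sup>+ y. v y \<partial>lborel)"
proof -
  have "(\<integral>\<^sup>+ x. \<integral>\<^sup>+ y. u (x - y) * v y \<partial>lborel \<partial>lborel)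
      = (\<integral>\<^sup>+ y. \<integral>\<^sup>+ x. u (x - y) * v y \<partial>lborel \<partial>lborel)"
    by (rule lborel_pair.Fubini'[symmetric]) measurable
  also have "\<dots> = (\<integral>\<^sup>+ y. (\<integral>\<^sup>+ x. u x \<partial>lborel) * v y \<partial>lborel)"
    by (intro nn_integral_cong) (simp add: nn_integral_multc nn_integral_lborel_shift)
  also have "\<dots> = (\<integral>\<^sup>+ x. u x \<partial>lborel) * (\<integral>\<^sup>+ y. v y \<partial>lborel)"
    by (simp add: nn_integral_cmult)
  finally show ?thesis .
qed

section \<open>The estimate for normalised functions\<close>

text \<open>The reals \<open>s\<close> and \<open>m\<close> stand for the essential infima of r' and
  r. They enter through the lower bounds in \<open>r\<close> and the two exponent
  identities.\<close>

lemma convolution_modular_le_1: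
  fixes p q s m :: real
    and r A B C D :: "real ^ 'n \<Rightarrow> ennreal"
    and k f :: "real ^ 'n \<Rightarrow> 'b::{real_normed_field, euclidean_space}"
  assumes pq: "1 < p" "1 < q" "1 / p + 1 / q = 1"
    and s: "0 < s" and m: "0 < m"
    and [measurable]: "A \<in> borel_measurable lebesgue" "B \<in> borel_measurable lebesgue"
      "C \<in> borel_measurable lebesgue" "D \<in> borel_measurable lebesgue"
    and r: "AE x in lebesgue. \<exists>\<rho>>1. r x = ennreal \<rho> \<and> m \<le> \<rho> \<and> s \<le> \<rho> / (\<rho> - 1)"
    and AC: "AE x in lebesgue. A x < \<infinity> \<and> C x < \<infinity> \<and> enn2real (A x) / (p * s) + enn2real (C x) / m = 1"
    and BD: "AE x in lebesgue. B x < \<infinity> \<and> D x < \<infinity> \<and> enn2real (B x) / (q * s) + enn2real (D x) / m = 1"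
    and k [measurable]: "k \<in> borel_measurable lebesgue"
    and f [measurable]: "f \<in> borel_measurable lebesgue"
    and k1: "AE x in lebesgue. norm (k x) \<le> 1" and f1: "AE x in lebesgue. norm (f x) \<le> 1"
    and mod: "modular A k \<le> 1" "modular C k \<le> 1" "modular B f \<le> 1" "modular D f \<le> 1"
  shows "AE x in lebesgue. integrable lebesgue (\<lambda>y. k (x - y) * f y)"
    and "convol k f \<in> borel_measurable lebesgue"
    and "modular r (convol k f) \<le> 1"
proof -
  obtain k' where [measurable]: "k' \<in> borel_measurable lborel" and k': "AE x in lborel. k x = k' x"
    using lebesgue_ex_borel[OF k] .
  obtain f' where [measurable]: "f' \<in> borel_measurable lborel" and f': "AE x in lborel. f x = f' x"
    using lebesgue_ex_borel[OF f] .
  note conv = convolution_AE_cong[OF k f \<open>k' \<in> _\<close> \<open>f' \<in> _\<close> k' f']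
  \<comment> \<open>\<open>conv(2)\<close> holds at every \<open>x\<close>, so the convolution
    coincides everywhere with a Borel function.\<close>
  have "(\<lambda>x. LINT y|lborel. k' (x - y) * f' y) \<in> borel_measurable lborel"
    by measurable
  then show "convol k f \<in> borel_measurable lebesgue"
    using conv(2) measurable_completion by (metis (no_types, lifting) ext)
  obtain kA where [measurable]: "kA \<in> borel_measurable lborel" and kA0: "\<And>x. 0 \<le> kA x"
    and kA: "AE x in lborel. norm (k x) powr enn2real (A x) = kA x"
    and kA1: "(\<integral>\<^sup>+ x. ennreal (kA x) \<partial>lborel) = modular A k"
    using AC by (elim modular_representative[OF k \<open>A \<in> _\<close>, rotated]) auto
  obtain kC where [measurable]: "kC \<in> borel_measurable lborel" and kC0: "\<And>x. 0 \<le> kC x"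
    and kC: "AE x in lborel. norm (k x) powr enn2real (C x) = kC x"
    and kC1: "(\<integral>\<^sup>+ x. ennreal (kC x) \<partial>lborel) = modular C k"
    using AC by (elim modular_representative[OF k \<open>C \<in> _\<close>, rotated]) auto
  obtain fB where [measurable]: "fB \<in> borel_measurable lborel" and fB0: "\<And>x. 0 \<le> fB x"
    and fB: "AE x in lborel. norm (f x) powr enn2real (B x) = fB x"
    and fB1: "(\<integral>\<^sup>+ x. ennreal (fB x) \<partial>lborel) = modular B f"
    using BD by (elim modular_representative[OF f \<open>B \<in> _\<close>, rotated]) auto
  obtain fD where [measurable]: "fD \<in> borel_measurable lborel" and fD0: "\<And>x. 0 \<le> fD x"
    and fD: "AE x in lborel. norm (f x) powr enn2real (D x) = fD x"
    and fD1: "(\<integral>\<^sup>+ x. ennreal (fD x) \<partial>lborel) = modular D f"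
    using BD by (elim modular_representative[OF f \<open>D \<in> _\<close>, rotated]) auto
  \<comment> \<open>The exponents stay merely Lebesgue measurable: they occur only pointwise in such
    a.e. identities, while the integrals below are formed from Borel functions.\<close>
  have KE: "AE x in lborel. norm (k' x) \<le> 1 \<and> kA x = norm (k' x) powr enn2real (A x)
      \<and> kC x = norm (k' x) powr enn2real (C x) \<and> enn2real (A x) / (p * s) + enn2real (C x) / m = 1"
    using k' kA kC k1[unfolded AE_completion_iff] AC[unfolded AE_completion_iff]
    by eventually_elim auto
  have FE: "AE x in lborel. norm (f' x) \<le> 1 \<and> fB x = norm (f' x) powr enn2real (B x)
      \<and> fD x = norm (f' x) powr enn2real (D x) \<and> enn2real (B x) / (q * s) + enn2real (D x) / m = 1"
    using f' fB fD f1[unfolded AE_completion_iff] BD[unfolded AE_completion_iff]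
    by eventually_elim auto
  define H where "H x = (\<integral>\<^sup>+ y. ennreal (kC (x - y)) * ennreal (fD y) \<partial>lborel)" for x
  have [measurable]: "H \<in> borel_measurable lborel"
    unfolding H_def by measurable
  \<comment> \<open>The bound obtained here also makes \<open>H\<close> finite a.e., so that its
    value can be taken as a real \<open>h\<close>.\<close>
  have "(\<integral>\<^sup>+ x. H x \<partial>lborel) = modular C k * modular D f"
    unfolding H_def by (subst nn_integral_convolution) (simp_all add: kC1 fD1)
  also have "\<dots> \<le> 1 * 1"
    using mod by (intro mult_mono) auto
  finally have H1: "(\<integral>\<^sup>+ x. H x \<partial>lborel) \<le> 1" by simp
  then have "(\<integral>\<^sup>+ x. H x \<partial>lborel) \<noteq> \<infinity>"
    by (auto simp: top_unique)
  then have Hfin: "AE x in lborel. H x \<noteq> \<infinity>"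
    by (intro nn_integral_PInf_AE) auto
  \<comment> \<open>Bounding the integral of the norm gives integrability and the bound on the
    convolution at once.\<close>
  define N where "N x = (\<integral>\<^sup>+ y. ennreal (norm (k' (x - y) * f' y)) \<partial>lborel)" for x
  have N_le: "N x \<le> ennreal (h powr (1 / \<rho>))"
    if \<rho>: "1 < \<rho>" "m \<le> \<rho>" "s \<le> \<rho> / (\<rho> - 1)" and h: "H x = ennreal h" "0 \<le> h" for x h \<rho>
  proof (rule dense_ge)
    fix z :: ennreal assume z: "ennreal (h powr (1 / \<rho>)) < z"
    show "N x \<le> z"
    proof (cases z)
      case (real t)
      then have t: "h powr (1 / \<rho>) < t"
        using z by (simp add: ennreal_less_iff)
      then have t0: "0 < t" by (meson le_less_trans powr_ge_zero)
      have "(h powr (1 / \<rho>)) powr \<rho> \<le> t powr \<rho>"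
        using t \<rho> by (intro powr_mono2) auto
      then have ht: "h \<le> t powr \<rho>"
        using \<rho> h by (simp add: powr_powr)
      \<comment> \<open>For fixed \<open>x\<close> the reflection preserves null sets, so the
        identities for \<open>k'\<close> at \<open>x - y\<close> hold together with those for
        \<open>f'\<close> at \<open>y\<close>, for almost every \<open>y\<close>.\<close>
      have "AE y in lborel. norm (k' (x - y) * f' y)
          \<le> t * ((1 - 1 / \<rho>) * (kA (x - y) / p + fB y / q) + kC (x - y) * fD y / (\<rho> * t powr \<rho>))"
        using AE_lborel_reflect[OF KE, of x] FE
      proof eventually_elim
        case (elim y)
        then have *: "kA (x - y) = norm (k' (x - y)) powr enn2real (A (x - y))"
          "kC (x - y) = norm (k' (x - y)) powr enn2real (C (x - y))"
          "fB y = norm (f' y) powr enn2real (B y)" "fD y = norm (f' y) powr enn2real (D y)"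
          by auto
        show ?case
          unfolding norm_mult *
          using elim pq s m \<rho> t0 by (intro powr_product_le[where s = s and m = m]) auto
      qed
      then have "N x \<le> (\<integral>\<^sup>+ y. ennreal
          (t * ((1 - 1 / \<rho>) * (kA (x - y) / p + fB y / q) + kC (x - y) * fD y / (\<rho> * t powr \<rho>))) \<partial>lborel)"
        unfolding N_def by (intro nn_integral_mono_AE) (auto elim!: eventually_mono intro: ennreal_leI)
      also have "\<dots> = (\<integral>\<^sup>+ y. ennreal t * (ennreal (1 - 1 / \<rho>) *
          (ennreal (1 / p) * ennreal (kA (x - y)) + ennreal (1 / q) * ennreal (fB y))
          + ennreal (1 / (\<rho> * t powr \<rho>)) * (ennreal (kC (x - y)) * ennreal (fD y))) \<partial>lborel)"
        using t0 \<rho> pq kA0 kC0 fB0 fD0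
        by (intro nn_integral_cong) (simp flip: ennreal_mult ennreal_plus)
      also have "\<dots> = ennreal t * (ennreal (1 - 1 / \<rho>) *
          (ennreal (1 / p) * modular A k + ennreal (1 / q) * modular B f)
          + ennreal (1 / (\<rho> * t powr \<rho>)) * H x)"
        unfolding H_def
        by (simp add: nn_integral_cmult nn_integral_add fB1 kA1
          nn_integral_lborel_reflect[of "\<lambda>y. ennreal (kA y)"])
      \<comment> \<open>The modulars are at most 1 and \<open>h \<le> t powr \<rho>\<close>. With
        \<open>1 / p + 1 / q = 1\<close> the bracket becomes
        \<open>(1 - 1 / \<rho>) + 1 / \<rho> = 1\<close>, which leaves \<open>t\<close>.\<close>
      also have "\<dots> \<le> ennreal t * (ennreal (1 - 1 / \<rho>) *
          (ennreal (1 / p) * 1 + ennreal (1 / q) * 1)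
          + ennreal (1 / (\<rho> * t powr \<rho>)) * ennreal (t powr \<rho>))"
        using mod h ht by (intro mult_left_mono add_mono) auto
      also have "\<dots> = ennreal (t * ((1 - 1 / \<rho>) * (1 / p + 1 / q) + 1 / (\<rho> * t powr \<rho>) * t powr \<rho>))"
        using t0 \<rho> pq(1,2) by (simp flip: ennreal_mult ennreal_plus)
      also have "t * ((1 - 1 / \<rho>) * (1 / p + 1 / q) + 1 / (\<rho> * t powr \<rho>) * t powr \<rho>) = t"
        using t0 \<rho> by (simp add: pq(3))
      finally show ?thesis using real by simp
    qed simp
  qed
  have main: "AE x in lborel. integrable lborel (\<lambda>y. k' (x - y) * f' y)
      \<and> omega (r x) (norm (convol k f x)) \<le> H x"
    using r[unfolded AE_completion_iff] Hfin
  proof eventually_elim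
    case (elim x)
    then obtain \<rho> where \<rho>: "1 < \<rho>" "r x = ennreal \<rho>" "m \<le> \<rho>" "s \<le> \<rho> / (\<rho> - 1)" by auto
    obtain h where h: "H x = ennreal h" "0 \<le> h" using elim(2) by (cases "H x") auto
    note N = N_le[OF \<rho>(1,3,4) h]
    have int: "integrable lborel (\<lambda>y. k' (x - y) * f' y)"
      using N unfolding N_def by (intro integrableI_bounded) (auto simp: le_less_trans)
    have "ennreal (norm (convol k f x)) \<le> N x"
      unfolding N_def conv(2) by (rule integral_norm_bound_ennreal[OF int])
    then have "norm (convol k f x) \<le> h powr (1 / \<rho>)"
      using N by (metis ennreal_le_iff order_trans powr_ge_zero)
    then have "norm (convol k f x) powr \<rho> \<le> (h powr (1 / \<rho>)) powr \<rho>"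
      using \<rho> by (intro powr_mono2) auto
    then have "norm (convol k f x) powr \<rho> \<le> h"
      using \<rho> h by (simp add: powr_powr)
    then show ?case
      using int \<rho> h by (auto simp: omega_def intro!: ennreal_leI)
  qed
  show "AE x in lebesgue. integrable lebesgue (\<lambda>y. k (x - y) * f y)"
    unfolding AE_completion_iff conv(1) using main by eventually_elim simp
  have "modular r (convol k f) \<le> (\<integral>\<^sup>+ x. H x \<partial>lborel)"
    unfolding modular_def nn_integral_completion using main by (intro nn_integral_mono_AE) auto
  with H1 show "modular r (convol k f) \<le> 1" by simp
qed


section \<open>Removing the normalisation\<close>

lemma convol_scaleR:
  fixes k f :: "real ^ 'n \<Rightarrow> 'b::{real_normed_field, euclidean_space}"
  shows "convol (\<lambda>x. k x /\<^sub>R a) (\<lambda>x. f x /\<^sub>R b) = (\<lambda>x. convol k f x /\<^sub>R (a * b))"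
  unfolding convol_def by (simp add: fun_eq_iff mult.commute)

text \<open>For the constant exponent infinity the modular takes only the values 0 and infinity, so
  being at most 1 forces it to vanish.\<close>

lemma AE_norm_le_of_Linf_norm_less:
  fixes f :: "real ^ 'n \<Rightarrow> 'b::real_normed_vector"
  assumes [measurable]: "f \<in> borel_measurable lebesgue" and "Linf_norm f < ennreal a"
  shows "AE x in lebesgue. norm (f x /\<^sub>R a) \<le> 1"
proof -
  have "modular (\<lambda>_. \<infinity>) (\<lambda>x. f x /\<^sub>R a) \<le> 1"
    by (rule modular_le_1_of_norm_less) fact
  then show ?thesis
    by (subst (asm) modular_infinity) (auto split: if_splits simp: top_unique)
qed

text \<open>Normalising constants must be positive and are chosen strictly above the norms. Adding
  the same \<open>e > 0\<close> to both factors and letting it tend to 0 recovers the product by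
  continuity.\<close>

lemma ennreal_le_mult_of_less:
  fixes x y z :: ennreal
  assumes "x < \<infinity>" "y < \<infinity>"
    and le: "\<And>a b. x < ennreal a \<Longrightarrow> y < ennreal b \<Longrightarrow> 0 < a \<Longrightarrow> 0 < b \<Longrightarrow> z \<le> ennreal (a * b)"
  shows "z \<le> x * y"
proof -
  obtain u v where u: "x = ennreal u" "0 \<le> u" and v: "y = ennreal v" "0 \<le> v"
    using assms(1,2) by (cases x; cases y) auto
  have "((\<lambda>e. ennreal ((u + e) * (v + e))) \<longlongrightarrow> ennreal ((u + 0) * (v + 0))) (at_right 0)"
    by (intro tendsto_intros)
  moreover have "\<forall>\<^sub>F e in at_right 0. z \<le> ennreal ((u + e) * (v + e))"
    using eventually_at_right_less[of "0::real"]
  proof eventually_elim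
    case (elim e)
    then show ?case
      using u v by (intro le) (auto simp: ennreal_less_iff)
  qed
  ultimately have "z \<le> ennreal ((u + 0) * (v + 0))"
    by (intro tendsto_lowerbound) auto
  then show ?thesis
    using u v by (simp add: ennreal_mult)
qed

text \<open>An infinite exponent over a finite denominator would make the sum infinite, so both are
  finite and the identity can be read in the reals.\<close>

lemma exponent_identity_real:
  fixes a c :: ennreal
  assumes "a / (ennreal p * ennreal s) + c / ennreal m = 1" and "0 < p" "0 < s" "0 < m"
  shows "a < \<infinity> \<and> c < \<infinity> \<and> enn2real a / (p * s) + enn2real c / m = 1"
proof -
  have ps: "ennreal p * ennreal s = ennreal (p * s)"
    using assms by (simp add: ennreal_mult)
  have "a \<noteq> \<infinity>" "c \<noteq> \<infinity>"
    using assms(1) by (auto simp: ps ennreal_top_divide)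
  then obtain a' c' where *: "a = ennreal a'" "0 \<le> a'" "c = ennreal c'" "0 \<le> c'"
    by (cases a; cases c) auto
  then have "ennreal (a' / (p * s) + c' / m) = ennreal 1"
    using assms by (simp add: ps divide_ennreal)
  then have "a' / (p * s) + c' / m = 1"
    using * assms by (subst (asm) ennreal_inj) auto
  then show ?thesis using * by simp
qed

theorem theorem3p9:
  fixes p q :: real
    and r A B C D :: "real ^ 'n \<Rightarrow> ennreal"
    and k f :: "real ^ 'n \<Rightarrow> 'b::{real_normed_field, euclidean_space}"
  assumes "1 < p" and "1 < q" and "1 / p + 1 / q = 1"
    and "r \<in> exponents" and "A \<in> exponents" and "B \<in> exponents"
    and "C \<in> exponents" and "D \<in> exponents"
    and "1 < essinf lebesgue r"
    and "essinf lebesgue r < esssup lebesgue r"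
    and "esssup lebesgue r < \<infinity>"
    and "AE x in lebesgue.
          A x / (ennreal p * essinf lebesgue (\<lambda>x. conj_exp (r x))) + C x / essinf lebesgue r = 1"
    and "AE x in lebesgue.
          B x / (ennreal q * essinf lebesgue (\<lambda>x. conj_exp (r x))) + D x / essinf lebesgue r = 1"
    and "k \<in> Lvar A \<inter> Lvar C \<inter> Linf"
    and "f \<in> Lvar B \<inter> Lvar D \<inter> Linf"
  shows "(AE x in lebesgue. integrable lebesgue (\<lambda>y. k (x - y) * f y)) \<and>
    convol k f \<in> Lvar r \<and>
    Lvar_norm r (convol k f) \<le>
      Max {Lvar_norm A k, Lvar_norm C k, Linf_norm k} *
      Max {Lvar_norm B f, Lvar_norm D f, Linf_norm f}"
proof -
  note pq = assms(1-3)
  have ABCD [measurable]: "A \<in> borel_measurable lebesgue" "B \<in> borel_measurable lebesgue"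
    "C \<in> borel_measurable lebesgue" "D \<in> borel_measurable lebesgue"
    and ABCD1: "\<And>x. 1 \<le> A x" "\<And>x. 1 \<le> B x" "\<And>x. 1 \<le> C x" "\<And>x. 1 \<le> D x"
    using assms(5-8) by (auto simp: exponents_def)
  have k [measurable]: "k \<in> borel_measurable lebesgue" and f [measurable]: "f \<in> borel_measurable lebesgue"
    using assms(14,15) by (auto simp: Lvar_def)
  have "essinf lebesgue r < \<infinity>"
    using assms(10,11) by (rule less_trans)
  then obtain m where m: "essinf lebesgue r = ennreal m" "1 < m"
    using assms(9) by (cases "essinf lebesgue r") (auto simp: ennreal_less_iff simp flip: ennreal_1)
  define S where "S = essinf lebesgue (\<lambda>x. conj_exp (r x))"
  have r_bounds: "AE x in lebesgue. \<exists>\<rho>>1. r x = ennreal \<rho> \<and> m \<le> \<rho>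
      \<and> conj_exp (r x) = ennreal (\<rho> / (\<rho> - 1)) \<and> S \<le> ennreal (\<rho> / (\<rho> - 1))"
    using essinf_AE[of lebesgue r] esssup_AE[of r lebesgue]
      essinf_AE[of lebesgue "\<lambda>x. conj_exp (r x)"]
  proof eventually_elim
    case (elim x)
    then have "r x < \<infinity>"
      using assms(11) by (metis le_less_trans)
    then obtain \<rho> where \<rho>: "r x = ennreal \<rho>" "0 \<le> \<rho>"
      by (cases "r x") auto
    moreover have "m \<le> \<rho>"
      using elim(1) m \<rho> by simp
    ultimately show ?case
      using m elim(3) conj_exp_ennreal[of \<rho>] unfolding S_def by (intro exI[of _ \<rho>]) auto
  qed
  \<comment> \<open>An infinite \<open>S\<close> would lie below finite conjugate exponents a.e.,
    which would make the whole space a null set.\<close>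
  have "S \<noteq> \<infinity>"
  proof
    assume "S = \<infinity>"
    then have "AE x in (lebesgue :: (real ^ 'n) measure). False"
      using r_bounds by (auto simp: top_unique)
    then show False
      using AE_iff_measurable[of UNIV lebesgue "\<lambda>_ :: real ^ 'n. False"] by simp
  qed
  moreover have "1 \<le> S"
    unfolding S_def essinf_def
  proof (rule Sup_upper, simp)
    show "AE x in lebesgue. 1 \<le> conj_exp (r x)"
      using r_bounds by eventually_elim (auto simp: field_simps simp flip: ennreal_1)
  qed
  ultimately obtain s where s: "S = ennreal s" "1 \<le> s"
    by (cases S) (auto simp flip: ennreal_1)
  have r': "AE x in lebesgue. \<exists>\<rho>>1. r x = ennreal \<rho> \<and> m \<le> \<rho> \<and> s \<le> \<rho> / (\<rho> - 1)"
    using r_bounds by eventually_elim (use s in \<open>auto simp: ennreal_le_iff2\<close>)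
  have AC: "AE x in lebesgue. A x < \<infinity> \<and> C x < \<infinity> \<and> enn2real (A x) / (p * s) + enn2real (C x) / m = 1"
    using assms(12) unfolding S_def[symmetric] s m
    by eventually_elim (use pq s m in \<open>intro exponent_identity_real; simp\<close>)
  have BD: "AE x in lebesgue. B x < \<infinity> \<and> D x < \<infinity> \<and> enn2real (B x) / (q * s) + enn2real (D x) / m = 1"
    using assms(13) unfolding S_def[symmetric] s m
    by eventually_elim (use pq s m in \<open>intro exponent_identity_real; simp\<close>)
  let ?K = "Max {Lvar_norm A k, Lvar_norm C k, Linf_norm k}"
  let ?F = "Max {Lvar_norm B f, Lvar_norm D f, Linf_norm f}"
  have fin: "?K < \<infinity>" "?F < \<infinity>"
    using assms(14,15) ABCD1 by (auto simp: Lvar_norm_finite[unfolded infinity_ennreal_def])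
  \<comment> \<open>Constants strictly above the maxima normalise with respect to all three norms of
    each function simultaneously.\<close>
  have scaled: "(AE x in lebesgue. integrable lebesgue (\<lambda>y. k (x - y) * f y)) \<and>
      convol k f \<in> borel_measurable lebesgue \<and> modular r (\<lambda>x. convol k f x /\<^sub>R (a * b)) \<le> 1"
    if ab: "?K < ennreal a" "?F < ennreal b" "0 < a" "0 < b" for a b
  proof -
    let ?k = "\<lambda>x. k x /\<^sub>R a" and ?f = "\<lambda>x. f x /\<^sub>R b"
    have m1: "?k \<in> borel_measurable lebesgue" "?f \<in> borel_measurable lebesgue"
      by measurable
    have ae: "AE x in lebesgue. norm (?k x) \<le> 1" "AE x in lebesgue. norm (?f x) \<le> 1"
      using ab by (auto intro!: AE_norm_le_of_Linf_norm_less simp del: norm_scaleR)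
    have mod: "modular A ?k \<le> 1" "modular C ?k \<le> 1" "modular B ?f \<le> 1" "modular D ?f \<le> 1"
      using ab by (auto intro!: modular_le_1_of_norm_less)
    have s0: "0 < s" and m0: "0 < m" using s m by auto
    note core = convolution_modular_le_1[OF pq s0 m0 ABCD r' AC BD m1 ae mod]
    have ab_inverse: "a * b * (inverse a * inverse b) = 1" "a * b * (inverse b * inverse a) = 1"
      using ab(3,4) by (simp_all add: field_simps)
    \<comment> \<open>Multiplying by \<open>a * b\<close> undoes the rescaling of the two
      factors.\<close>
    have int: "AE x in lebesgue. integrable lebesgue (\<lambda>y. k (x - y) * f y)"
      using core(1)
    proof eventually_elim
      case (elim x)
      then have "integrable lebesgue (\<lambda>y. (a * b) *\<^sub>R (?k (x - y) * ?f y))"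
        by (intro integrable_scaleR_right)
      then show ?case
        by (simp add: ab_inverse)
    qed
    have "(\<lambda>x. (a * b) *\<^sub>R convol ?k ?f x) \<in> borel_measurable lebesgue"
      using core(2) by measurable
    then have "convol k f \<in> borel_measurable lebesgue"
      unfolding convol_scaleR by (simp add: ab_inverse)
    then show ?thesis
      using int core(3) unfolding convol_scaleR by blast
  qed
  have ex: "\<exists>a>0. x < ennreal a" if "x < \<infinity>" for x
    using that by (cases x) (auto simp: ennreal_less_iff intro!: exI[of _ "enn2real x + 1"])
  \<comment> \<open>One such pair suffices for membership, with the scale
    \<open>inverse (a * b)\<close>; the norm bound uses all pairs.\<close>
  obtain a b where ab: "?K < ennreal a" "?F < ennreal b" "0 < a" "0 < b"
    using ex[OF fin(1)] ex[OF fin(2)] by blast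
  have "convol k f \<in> Lvar r"
    unfolding Lvar_def
    using scaled[OF ab] ab by (auto intro!: exI[of _ "inverse (a * b)"] intro: le_less_trans)
  moreover have "Lvar_norm r (convol k f) \<le> ?K * ?F"
  proof (rule ennreal_le_mult_of_less[OF fin])
    fix a b assume ab: "?K < ennreal a" "?F < ennreal b" "0 < a" "0 < b"
    then have "0 < a * b" "modular r (\<lambda>x. convol k f x /\<^sub>R (a * b)) \<le> 1"
      using scaled[OF ab] by simp_all
    then show "Lvar_norm r (convol k f) \<le> ennreal (a * b)"
      unfolding Lvar_norm_def by (intro Inf_lower) blast
  qed
  ultimately show ?thesis
    using scaled[OF ab] by blast
qed

end
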